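(* Let $(\mathfrak{g},[~,~],\alpha)$ be a (multiplicative) Hom-Lie algebra and let $N:\mathfrak{g}\to\mathfrak{g}$ be a linear map satisfying $\alpha\circ N=N\circ\alpha$. Then $N$ is a Nijenhuis operator on the Hom-Lie algebra $\mathfrak{g}$ if and only if $[N,N]_{\mathsf{FN}}=0$.
   Context: All vector spaces and (multi)linear maps are over a field $\mathbf{k}$ of characteristic $0$. A (multiplicative) Hom-Lie algebra $(\mathfrak{g},[~,~],\alpha)$ is a vector space $\mathfrak{g}$ with a skew-symmetric bilinear map $[~,~]$ and a linear map $\alpha:\mathfrak{g}\to\mathfrak{g}$ such that $[\alpha(x),[y,z]]+[\alpha(y),[z,x]]+[\alpha(z),[x,y]]=0$ and $\alpha([x,y])=[\alpha(x),\alpha(y)]$. A linear map $N:\mathfrak{g}\to\mathfrak{g}$ with $\alpha\circ N=N\circ\alpha$ is a Nijenhuis operator if $[Nx,Ny]=N([Nx,y]+[x,Ny]-N[x,y])$ for all $x,y\in\mathfrak{g}$. For $n\ge1$, $C^n_{\mathrm{Hom}}(\mathfrak{g},\mathfrak{g})=\{f:\wedge^n\mathfrak{g}\to\mathfrak{g}\mid\alpha\circ f=f\circ\alpha^{\wedge n}\}$, so the given $N$ lies in $C^1_{\mathrm{Hom}}(\mathfrak{g},\mathfrak{g})$. $Sh(m,n)$ is the set of $(m,n)$-shuffles. For $P\in C^m_{\mathrm{Hom}}(\mathfrak{g},\mathfrak{g})$, $Q\in C^n_{\mathrm{Hom}}(\mathfrak{g},\mathfrak{g})$: $$(i_PQ)(x_1,\ldots,x_{m+n-1})=\sum_{\sigma\in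 Sh(m,n-1)}(-1)^\sigma Q\big(P(x_{\sigma(1)},\ldots,x_{\sigma(m)}),\alpha^{m-1}x_{\sigma(m+1)},\ldots,\alpha^{m-1}x_{\sigma(m+n-1)}\big),$$ $$[P,Q]_{\mathsf{C}}(x_1,\ldots,x_{m+n})=\sum_{\sigma\in Sh(m,n)}(-1)^\sigma[\alpha^{n-1}P(x_{\sigma(1)},\ldots,x_{\sigma(m)}),\alpha^{m-1}Q(x_{\sigma(m+1)},\ldots,x_{\sigma(m+n)})],$$ $$(\delta_{\mathrm{Hom}}P)(x_1,\ldots,x_{m+1})=\sum_{i=1}^{m+1}(-1)^{i+1}[\alpha^{m-1}(x_i),P(x_1,\ldots,\widehat{x_i},\ldots,x_{m+1})]+\sum_{i<j}(-1)^{i+j}P([x_i,x_j],\alpha(x_1),\ldots,\widehat{\alpha(x_i)},\ldots,\widehat{\alpha(x_j)},\ldots,\alpha(x_{m+1})),$$ $$[P,Q]_{\mathsf{FN}}=[P,Q]_{\mathsf{C}}+(-1)^m\,i_{(\delta_{\mathrm{Hom}}P)}Q-(-1)^{(m+1)n}\,i_{(\delta_{\mathrm{Hom}}Q)}P.$$ *)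

theory Defs
  imports Complex_Main "HOL-Combinatorics.Permutations"
begin

locale hom_lie_algebra = vector_space scale
  for scale :: "'k::field_char_0 \<Rightarrow> 'g::ab_group_add \<Rightarrow> 'g" (infixr "*s" 75) +
  fixes br :: "'g \<Rightarrow> 'g \<Rightarrow> 'g"
    and \<alpha> :: "'g \<Rightarrow> 'g"
  assumes br_linear_left: "Vector_Spaces.linear scale scale (\<lambda>x. br x y)"
    and br_linear_right: "Vector_Spaces.linear scale scale (\<lambda>y. br x y)"
    and br_skew: "br x y = - br y x"
    and alpha_linear: "Vector_Spaces.linear scale scale \<alpha>"
    and hom_jacobi: "br (\<alpha> x) (br y z) + br (\<alpha> y) (br z x) + br (\<alpha> z) (br x y) = 0"
    and alpha_mult: "\<alpha> (br x y) = br (\<alpha> x) (\<alpha> y)"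

text \<open>
  Positions are counted from 0 (also in the sums below), so a shuffle permutes
  \<open>{0, \<dots>, m + n - 1}\<close>.
\<close>

definition shuffles_of :: "nat \<Rightarrow> nat \<Rightarrow> (nat \<Rightarrow> nat) set" where
  "shuffles_of m n = {\<sigma>. \<sigma> permutes {..<m + n} \<and>
     strict_mono_on {..<m} \<sigma> \<and> strict_mono_on {m..<m + n} \<sigma>}"

text \<open>A linear map as a cochain of degree 1 (see \<open>cochains\<close> below).\<close>

definition one_cochain :: "('g::zero \<Rightarrow> 'g) \<Rightarrow> 'g list \<Rightarrow> 'g" where
  "one_cochain N xs = (if length xs = 1 then N (xs ! 0) else 0)"

context hom_lie_algebra
begin

definition nijenhuis_operator :: "('g \<Rightarrow> 'g) \<Rightarrow> bool" where
  "nijenhuis_operator N \<longleftrightarrow>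
     Vector_Spaces.linear scale scale N \<and> \<alpha> \<circ> N = N \<circ> \<alpha> \<and>
     (\<forall>x y. br (N x) (N y) = N (br (N x) y + br x (N y) - N (br x y)))"

text \<open>
  An \<open>n\<close>-cochain, i.e. a linear map on the \<open>n\<close>-th exterior power, is an alternating
  \<open>n\<close>-linear map on argument lists of length \<open>n\<close>. It is extended by 0 to lists of
  any other length, so that equality of cochains is equality of functions. The degree
  of a cochain is not recoverable from the function (the zero cochain has all degrees),
  hence the operations below take the degrees as arguments.
\<close>

definition cochains :: "nat \<Rightarrow> ('g list \<Rightarrow> 'g) set" where
  "cochains n = {f.
     (\<forall>xs. length xs \<noteq> n \<longrightarrow> f xs = 0) \<and>
     (\<forall>xs ys. length xs + 1 + length ys = n \<longrightarrow>
        Vector_Spaces.linear scale scale (\<lambda>x. f (xs @ x # ys))) \<and>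
     (\<forall>xs. length xs = n \<longrightarrow> \<not> distinct xs \<longrightarrow> f xs = 0) \<and>
     (\<forall>xs. length xs = n \<longrightarrow> \<alpha> (f xs) = f (map \<alpha> xs))}"

lemma one_cochain_in_cochains:
  assumes "Vector_Spaces.linear scale scale N" "\<alpha> \<circ> N = N \<circ> \<alpha>"
  shows "one_cochain N \<in> cochains 1"
  using assms by (auto simp: cochains_def one_cochain_def length_Suc_conv fun_eq_iff)

definition insertion ::
  "nat \<Rightarrow> nat \<Rightarrow> ('g list \<Rightarrow> 'g) \<Rightarrow> ('g list \<Rightarrow> 'g) \<Rightarrow> 'g list \<Rightarrow> 'g" where
  "insertion m n P Q xs =
     (if length xs = m + n - 1 then
        (\<Sum>\<sigma> \<in> shuffles_of m (n - 1). of_int (sign \<sigma>) *s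
           Q (P (map (\<lambda>i. xs ! \<sigma> i) [0..<m]) #
              map (\<lambda>i. (\<alpha> ^^ (m - 1)) (xs ! \<sigma> i)) [m..<m + n - 1]))
      else 0)"

definition cup_bracket ::
  "nat \<Rightarrow> nat \<Rightarrow> ('g list \<Rightarrow> 'g) \<Rightarrow> ('g list \<Rightarrow> 'g) \<Rightarrow> 'g list \<Rightarrow> 'g" where
  "cup_bracket m n P Q xs =
     (if length xs = m + n then
        (\<Sum>\<sigma> \<in> shuffles_of m n. of_int (sign \<sigma>) *s
           br ((\<alpha> ^^ (n - 1)) (P (map (\<lambda>i. xs ! \<sigma> i) [0..<m])))
              ((\<alpha> ^^ (m - 1)) (Q (map (\<lambda>i. xs ! \<sigma> i) [m..<m + n]))))
      else 0)"

text \<open>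
  \<open>nths xs (- {i})\<close> is \<open>xs\<close> with the entry at position \<open>i\<close> omitted. Counting from 0
  turns the customary sign \<open>(-1)\<^sup>i\<^sup>+\<^sup>1\<close> into \<open>(-1)\<^sup>i\<close> and leaves \<open>(-1)\<^sup>i\<^sup>+\<^sup>j\<close> unchanged.
\<close>

definition coboundary :: "nat \<Rightarrow> ('g list \<Rightarrow> 'g) \<Rightarrow> 'g list \<Rightarrow> 'g" where
  "coboundary m P xs =
     (if length xs = m + 1 then
        (\<Sum>i<m + 1. (-1) ^ i *s br ((\<alpha> ^^ (m - 1)) (xs ! i)) (P (nths xs (- {i})))) +
        (\<Sum>j<m + 1. \<Sum>i<j. (-1) ^ (i + j) *s
           P (br (xs ! i) (xs ! j) # map \<alpha> (nths xs (- {i, j}))))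
      else 0)"

definition fn_bracket ::
  "nat \<Rightarrow> nat \<Rightarrow> ('g list \<Rightarrow> 'g) \<Rightarrow> ('g list \<Rightarrow> 'g) \<Rightarrow> 'g list \<Rightarrow> 'g" where
  "fn_bracket m n P Q xs =
     cup_bracket m n P Q xs
     + (-1) ^ m *s insertion (m + 1) n (coboundary m P) Q xs
     - (-1) ^ ((m + 1) * n) *s insertion (n + 1) m (coboundary n Q) P xs"

end

end

theory Submission
  imports Defs
begin

text \<open>
  Both sides of the equivalence are statements about one expression, the torsion
  \<open>T x y = [N x, N y] - N ([N x, y] + [x, N y] - N [x, y])\<close>: the bracket \<open>[N, N]\<close> on the
  arguments \<open>x, y\<close> equals \<open>2 T x y\<close>, and 2 is invertible in characteristic 0.

  In these degrees \<open>\<alpha>\<close> occurs only as \<open>\<alpha>\<^sup>0\<close> or on an empty list of arguments, which is why the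
  torsion is an expression in the Lie bracket and \<open>N\<close> alone. The cup bracket has two shuffles, whose
  terms agree by skew-symmetry of the Hom-Lie bracket and give \<open>2 [N x, N y]\<close>
  (\<open>cup_bracket_one_cochain\<close>). The coboundary of \<open>N\<close> is
  \<open>[N x, y] + [x, N y] - N [x, y]\<close>, again by skew-symmetry (\<open>coboundary_one_cochain\<close>), and inserting
  it into the 1-cochain \<open>N\<close> is composition with \<open>N\<close>, since an insertion into a single slot has only
  the trivial shuffle (\<open>insertion_into_1\<close>). Both insertion terms of the bracket carry the sign
  \<open>-1\<close>, so together they contribute \<open>-2 N ([N x, y] + [x, N y] - N [x, y])\<close>.
\<close>

text \<open>
  A strictly increasing map of \<open>{..<m}\<close> into the naturals never falls below the identity, and a
  permutation of a finite set of naturals with this property is the identity.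
\<close>
lemma shuffles_of_0_right: "shuffles_of m 0 = {id}"
proof -
  have "\<sigma> = id" if perm: "\<sigma> permutes {..<m}" and mono: "strict_mono_on {..<m} \<sigma>" for \<sigma>
  proof -
    have "i < m \<Longrightarrow> i \<le> \<sigma> i" for i
    proof (induction i)
      case (Suc i)
      then have "\<sigma> i < \<sigma> (Suc i)"
        using mono by (simp add: strict_mono_on_def)
      with Suc show ?case by simp
    qed simp
    with perm show ?thesis by (intro permutes_natset_ge) auto
  qed
  then show ?thesis
    by (auto simp: shuffles_of_def permutes_id strict_mono_on_def)
qed

lemma shuffles_of_1_1: "shuffles_of 1 1 = {id, transpose 0 1}"
proof -
  have "{..<1 + 1} = {0, 1::nat}" by auto
  then show ?thesis
    by (auto simp: shuffles_of_def permutes_doubleton_iff strict_mono_on_def)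
qed

context hom_lie_algebra
begin

lemma insertion_into_1:
  "insertion m 1 P Q xs = (if length xs = m then Q [P xs] else 0)"
proof -
  have "map (\<lambda>i. xs ! i) [0..<m] = xs" if "length xs = m"
    using that map_nth by blast
  then show ?thesis
    by (simp add: insertion_def shuffles_of_0_right)
qed

lemma cup_bracket_one_cochain:
  "cup_bracket 1 1 (one_cochain N) (one_cochain N) [x, y] = 2 *s br (N x) (N y)"
proof -
  have "id \<noteq> transpose 0 (1::nat)"
    by (metis id_apply transpose_apply_first zero_neq_one)
  then have "cup_bracket 1 1 (one_cochain N) (one_cochain N) [x, y] = br (N x) (N y) - br (N y) (N x)"
    unfolding cup_bracket_def shuffles_of_1_1
    by (simp add: one_cochain_def sign_swap_id)
  also have "\<dots> = br (N x) (N y) + br (N x) (N y)"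
    using br_skew[of "N y" "N x"] by simp
  finally show ?thesis
    using scale_left_distrib[of 1 1] by simp
qed

lemma coboundary_one_cochain:
  "coboundary 1 (one_cochain N) [x, y] = br (N x) y + br x (N y) - N (br x y)"
proof -
  have "nths [x, y] (- {0}) = [y]" "nths [x, y] (- {Suc 0}) = [x]"
    "nths [x, y] (- {0, Suc 0}) = []"
    by (simp_all add: nths_Cons)
  then have "coboundary 1 (one_cochain N) [x, y] = br x (N y) - br y (N x) - N (br x y)"
    by (simp add: coboundary_def one_cochain_def numeral_2_eq_2)
  then show ?thesis
    using br_skew[of y "N x"] by simp
qed

lemma fn_bracket_one_cochain:
  "fn_bracket 1 1 (one_cochain N) (one_cochain N) [x, y] =
     2 *s (br (N x) (N y) - N (br (N x) y + br x (N y) - N (br x y)))"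
proof -
  have "insertion (1 + 1) 1 (coboundary 1 (one_cochain N)) (one_cochain N) [x, y] =
      N (br (N x) y + br x (N y) - N (br x y))" (is "_ = ?I")
    unfolding insertion_into_1 coboundary_one_cochain by (simp add: one_cochain_def)
  then have "fn_bracket 1 1 (one_cochain N) (one_cochain N) [x, y] =
      2 *s br (N x) (N y) - (?I + ?I)"
    unfolding fn_bracket_def cup_bracket_one_cochain by simp
  moreover have "?I + ?I = 2 *s ?I"
    using scale_left_distrib[of 1 1 ?I] by simp
  ultimately show ?thesis
    by (simp add: scale_right_diff_distrib)
qed

lemma fn_bracket_1_1_eq_0_iff:
  "fn_bracket 1 1 P Q = (\<lambda>xs. 0) \<longleftrightarrow> (\<forall>x y. fn_bracket 1 1 P Q [x, y] = 0)"
proof -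
  have "fn_bracket 1 1 P Q xs = 0" if "length xs \<noteq> 2" for xs
    using that by (simp add: fn_bracket_def cup_bracket_def insertion_def)
  moreover have "\<exists>x y. xs = [x, y]" if "length xs = 2" for xs :: "'g list"
    using that by (auto simp: numeral_2_eq_2 length_Suc_conv)
  ultimately show ?thesis
    by (metis ext)
qed

end

theorem mainTheorem9:
  fixes scale :: "'k::field_char_0 \<Rightarrow> 'g::ab_group_add \<Rightarrow> 'g"
    and br :: "'g \<Rightarrow> 'g \<Rightarrow> 'g"
    and \<alpha> N :: "'g \<Rightarrow> 'g"
  assumes "hom_lie_algebra scale br \<alpha>"
    and "Vector_Spaces.linear scale scale N"
    and "\<alpha> \<circ> N = N \<circ> \<alpha>"
  shows "hom_lie_algebra.nijenhuis_operator scale br \<alpha> N \<longleftrightarrow>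
    hom_lie_algebra.fn_bracket scale br \<alpha> 1 1 (one_cochain N) (one_cochain N) =
      (\<lambda>xs. 0)"
proof -
  interpret hom_lie_algebra scale br \<alpha> by fact
  show ?thesis
    unfolding fn_bracket_1_1_eq_0_iff fn_bracket_one_cochain nijenhuis_operator_def
    using assms(2,3) by simp
qed

end
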